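(* The recurrences of single-layer T-GRU, T-LSTM, and QRNN are rational (over the real semiring). In particular, a single-layer $d$-dimensional QRNN using $K$-window convolutions can be recovered by a set of $d$ WFSAs, each with $O(2\,|\Sigma|^{K-1})$ states, where $\Sigma$ is the input alphabet.
   Context: Models. QRNN = quasi-RNN; T-LSTM and T-GRU = gated variants of strongly-typed RNNs. Only the recurrent computation, i.e. how the hidden state $\mathbf{c}_t$ is computed, is considered. Let $\Sigma$ be a finite alphabet; for an input sequence $\mathbf{x}=x_1\dots x_n$ over $\Sigma$, let $\mathbf{v}_t$ be the word embedding vector of $x_t$. In all three models the hidden state is updated by $\mathbf{c}_t=\mathbf{f}_t\odot\mathbf{c}_{t-1}+\mathbf{u}_t$ with $\mathbf{c}_0=\mathbf{0}$ ($\odot$ the elementwise product), where the gate $\mathbf{f}_t$ and the input representation $\mathbf{u}_t$ may depend on previous inputs (but not on previous hidden states): - T-LSTM and T-GRU: the forget gate is a function of two consecutive inputs, $\mathbf{f}_t=\bm\sigma(\mathbf{V}_f\mathbf{v}_{t-1}+\mathbf{W}_f\mathbf{v}_t+\mathbf{b}_f)$, with $\bm\sigma$ the elementwise sigmoid. - QRNN with $K$-window convolutions: similar, but $\mathbf{f}_t$ and $\mathbf{u}_t$ may depend on up to $K$ consecutive tokens (the current one and those preceding it). For $K=2$: $\mathbf{f}_t=\bm\sigma(\mathbf{V}_f\mathbf{v}_{t-1}+\mathbf{W}_f\mathbf{v}_t+\mathbf{b}_f)$ and $\mathbf{u}_t=(\mathbf{1}-\mathbf{f}_t)\odot\bm g(\mathbf{V}_u\mathbf{v}_{t-1}+\mathbf{W}_u\mathbf{v}_t+\mathbf{b}_u)$,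 with $\bm g$ an optional elementwise nonlinearity and $\mathbf{1}$ the all-ones vector. The $\mathbf{V}$'s, $\mathbf{W}$'s and $\mathbf{b}$'s are real parameter matrices and vectors. The function whose recurrence is considered is $\mathbf{c}:\Sigma^\ast\to\mathbb{R}^d$, $\mathbf{c}(x_1\dots x_t)=\mathbf{c}_t$; a set of $d$ WFSAs recovers the model if the $i$th WFSA's string score gives the $i$th coordinate of $\mathbf{c}$. A weighted finite-state automaton (WFSA) over a semiring $\langle\mathbb{K},\oplus,\otimes,\bar0,\bar1\rangle$ is a tuple $\mathscr{A}=\langle\Sigma,\mathcal{Q},\tau,\lambda,\rho\rangle$ with finite alphabet $\Sigma$, finite state set $\mathcal{Q}$, transition weights $\tau:\mathcal{Q}\times\mathcal{Q}\times(\Sigma\cup\{\varepsilon\})\to\mathbb{K}$ (with $\varepsilon\notin\Sigma$ marking transitions that consume no input), initial weights $\lambda:\mathcal{Q}\to\mathbb{K}$ and final weights $\rho:\mathcal{Q}\to\mathbb{K}$. A path $\bm\pi=\pi_1\dots\pi_n$ is a sequence of adjacent transitions $\pi_k=(q_k,q_{k+1},z_k)$; it derives the string obtained from $z_1\dots z_n$ by deleting all $\varepsilon$'s. Its score is $\mathscr{A}[\bm\pi]=\lambda(q_1)\otimes\bigl(\bigotimes_{k=1}^n\tau(\pi_k)\bigr)\otimes\rho(q_{n+1})$. The score of a string $\mathbf{x}$ is $\mathscr{A}\llbracket\mathbf{x}\rrbracket=\bigoplus_{\bm\pi}\mathscr{A}[\bm\pi]$, summed over all paths deriving $\mathbf{x}$.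 Rational recurrence: for a function $\mathbf{c}:\Sigma^\ast\to\mathbb{K}^d$, its recurrence is the dependence of $\mathbf{c}(x_1\dots x_t)$ on $\mathbf{c}(x_1\dots x_{t-1})$. The recurrence is rational if there is a set of WFSAs $\{\mathscr{A}_i\}_{i=1}^d$ over alphabet $\Sigma$ and semiring $\langle\mathbb{K},\oplus,\otimes,\bar0,\bar1\rangle$, with both $\oplus$ and $\otimes$ taking constant time and space, such that $[\mathbf{c}(\mathbf{x})]_i=\mathscr{A}_i\llbracket\mathbf{x}\rrbracket$ for all $\mathbf{x}\in\Sigma^\ast$ and all $i\in\{1,\dots,d\}$. Here the semiring is the real semiring $\langle\mathbb{R},+,\cdot,0,1\rangle$. *)

theory Defs
  imports "HOL-Analysis.Infinite_Sum" "Jordan_Normal_Form.Matrix"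
begin

section \<open>Weighted finite-state automata\<close>

text \<open>The symbol \<open>\<epsilon>\<close> is \<open>None\<close>; a letter \<open>a\<close> of the alphabet is \<open>Some a\<close>.\<close>

record ('a, 'q, 'k) wfsa =
  alphabet :: "'a set"
  states :: "'q set"
  trans :: "'q \<Rightarrow> 'q \<Rightarrow> 'a option \<Rightarrow> 'k"
  init :: "'q \<Rightarrow> 'k"
  final :: "'q \<Rightarrow> 'k"

definition is_wfsa :: "('a, 'q, 'k) wfsa \<Rightarrow> bool" where
  "is_wfsa A \<longleftrightarrow> finite (alphabet A) \<and> finite (states A)"

text \<open>
  A path is a start state together with the list of its transitions
  \<open>(q\<^sub>k, q\<^sub>k\<^sub>+\<^sub>1, z\<^sub>k)\<close>.  The start state is recorded separately
  because a path may have no transitions.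
\<close>

type_synonym ('a, 'q) path = "'q \<times> ('q \<times> 'q \<times> 'a option) list"

fun is_path :: "('a, 'q, 'k) wfsa \<Rightarrow> ('a, 'q) path \<Rightarrow> bool" where
  "is_path A (q, []) \<longleftrightarrow> q \<in> states A"
| "is_path A (q, (p, r, z) # ts) \<longleftrightarrow>
     q \<in> states A \<and> p = q \<and> z \<in> insert None (Some ` alphabet A) \<and> is_path A (r, ts)"

fun path_end :: "('a, 'q) path \<Rightarrow> 'q" where
  "path_end (q, []) = q"
| "path_end (q, (p, r, z) # ts) = path_end (r, ts)"

definition path_string :: "('a, 'q) path \<Rightarrow> 'a list" where
  "path_string \<pi> = List.map_filter (\<lambda>(p, r, z). z) (snd \<pi>)"

definition path_score :: "('a, 'q, 'k::monoid_mult) wfsa \<Rightarrow> ('a, 'q) path \<Rightarrow> 'k" where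
  "path_score A \<pi> =
     init A (fst \<pi>) * prod_list (map (\<lambda>(p, r, z). trans A p r z) (snd \<pi>)) * final A (path_end \<pi>)"

text \<open>
  Because of \<open>\<epsilon>\<close>-transitions a string is in general derived by infinitely many paths.
  The score is therefore an unordered (over the reals: absolutely convergent) infinite sum, and
  having a score includes convergence of that sum.
\<close>

definition has_string_score ::
  "('a, 'q, 'k::{semiring_1, t2_space}) wfsa \<Rightarrow> 'a list \<Rightarrow> 'k \<Rightarrow> bool" where
  "has_string_score A x s \<longleftrightarrow>
     (path_score A has_sum s) {\<pi>. is_path A \<pi> \<and> path_string \<pi> = x}"

section \<open>Rational recurrences\<close>

text \<open>
  The functions are only constrained on \<open>lists \<Sigma>\<close>, i.e. on \<open>\<Sigma>\<^sup>*\<close>; coordinates are numbered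
  from 0.  Taking states to be natural numbers is no restriction, since state sets are finite.
\<close>

definition recovers ::
  "'a set \<Rightarrow> nat \<Rightarrow> ('a list \<Rightarrow> 'k vec) \<Rightarrow> (nat \<Rightarrow> ('a, nat, 'k::{semiring_1, t2_space}) wfsa) \<Rightarrow> bool"
  where
  "recovers \<Sigma> d c A \<longleftrightarrow>
     (\<forall>i<d. is_wfsa (A i) \<and> alphabet (A i) = \<Sigma> \<and>
            (\<forall>x\<in>lists \<Sigma>. has_string_score (A i) x (c x $ i)))"

definition rational_recurrence ::
  "'a set \<Rightarrow> nat \<Rightarrow> ('a list \<Rightarrow> 'k::{semiring_1, t2_space} vec) \<Rightarrow> bool" where
  "rational_recurrence \<Sigma> d c \<longleftrightarrow> (\<exists>A. recovers \<Sigma> d c A)"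

section \<open>Recurrent models\<close>

definition sigmoid :: "real \<Rightarrow> real" where
  "sigmoid r = 1 / (1 + exp (- r))"

primrec hidden_state :: "nat \<Rightarrow> (nat \<Rightarrow> real vec) \<Rightarrow> (nat \<Rightarrow> real vec) \<Rightarrow> nat \<Rightarrow> real vec" where
  "hidden_state d f u 0 = 0\<^sub>v d"
| "hidden_state d f u (Suc t) = component_mult (f (Suc t)) (hidden_state d f u t) + u (Suc t)"

text \<open>
  The vector \<open>v\<^sub>t\<close> of the \<open>t\<close>-th token, with tokens numbered from 1.  All positions before the
  start of the sequence are represented by position 0 (truncated subtraction of naturals maps
  them there) and carry a padding vector \<open>p\<close>, for instance \<open>0\<close>.
\<close>

definition token_vec :: "('a \<Rightarrow> real vec) \<Rightarrow> real vec \<Rightarrow> 'a list \<Rightarrow> nat \<Rightarrow> real vec" where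
  "token_vec v p x t = (if t = 0 then p else v (x ! (t - 1)))"

subsection \<open>T-LSTM and T-GRU\<close>

text \<open>
  T-LSTM and T-GRU share the forget gate and differ in the input representation
  \<open>u\<^sub>t\<close>, which in both is determined by \<open>v\<^sub>t\<^sub>-\<^sub>1\<close> and \<open>v\<^sub>t\<close>.  It is kept
  arbitrary here: \<open>t_inp a b\<close> is the value of \<open>u\<^sub>t\<close> for \<open>v\<^sub>t\<^sub>-\<^sub>1 = a\<close> and \<open>v\<^sub>t = b\<close>.
\<close>

record 'a t_rnn =
  t_dim :: nat
  t_emb_dim :: nat
  t_emb :: "'a \<Rightarrow> real vec"
  t_pad :: "real vec"
  t_Vf :: "real mat"
  t_Wf :: "real mat"
  t_bf :: "real vec"
  t_inp :: "real vec \<Rightarrow> real vec \<Rightarrow> real vec"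

definition is_t_rnn :: "'a set \<Rightarrow> 'a t_rnn \<Rightarrow> bool" where
  "is_t_rnn \<Sigma> M \<longleftrightarrow>
     t_emb M ` \<Sigma> \<subseteq> carrier_vec (t_emb_dim M) \<and>
     t_pad M \<in> carrier_vec (t_emb_dim M) \<and>
     t_Vf M \<in> carrier_mat (t_dim M) (t_emb_dim M) \<and>
     t_Wf M \<in> carrier_mat (t_dim M) (t_emb_dim M) \<and>
     t_bf M \<in> carrier_vec (t_dim M) \<and>
     (\<forall>a\<in>carrier_vec (t_emb_dim M). \<forall>b\<in>carrier_vec (t_emb_dim M).
        t_inp M a b \<in> carrier_vec (t_dim M))"

definition t_forget :: "'a t_rnn \<Rightarrow> 'a list \<Rightarrow> nat \<Rightarrow> real vec" where
  "t_forget M x t =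
     (let v = token_vec (t_emb M) (t_pad M) x
      in map_vec sigmoid (t_Vf M *\<^sub>v v (t - 1) + t_Wf M *\<^sub>v v t + t_bf M))"

definition t_input :: "'a t_rnn \<Rightarrow> 'a list \<Rightarrow> nat \<Rightarrow> real vec" where
  "t_input M x t =
     (let v = token_vec (t_emb M) (t_pad M) x in t_inp M (v (t - 1)) (v t))"

definition t_rnn_state :: "'a t_rnn \<Rightarrow> 'a list \<Rightarrow> real vec" where
  "t_rnn_state M x = hidden_state (t_dim M) (t_forget M x) (t_input M x) (length x)"

subsection \<open>QRNN with windowed convolutions\<close>

text \<open>
  For a window of size \<open>K\<close> the matrix with index \<open>j < K\<close> acts on \<open>v\<^sub>t\<^sub>-\<^sub>j\<close>, so for \<open>K = 2\<close>
  the matrices with indices 0 and 1 are the usual \<open>W\<close> and \<open>V\<close>.  The elementwise nonlinearity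
  \<open>q_g\<close> may be the identity, which makes it optional.
\<close>

record 'a qrnn =
  q_dim :: nat
  q_emb_dim :: nat
  q_window :: nat
  q_emb :: "'a \<Rightarrow> real vec"
  q_pad :: "real vec"
  q_Wf :: "nat \<Rightarrow> real mat"
  q_bf :: "real vec"
  q_Wu :: "nat \<Rightarrow> real mat"
  q_bu :: "real vec"
  q_g :: "real \<Rightarrow> real"

definition is_qrnn :: "'a set \<Rightarrow> 'a qrnn \<Rightarrow> bool" where
  "is_qrnn \<Sigma> M \<longleftrightarrow>
     1 \<le> q_window M \<and>
     q_emb M ` \<Sigma> \<subseteq> carrier_vec (q_emb_dim M) \<and>
     q_pad M \<in> carrier_vec (q_emb_dim M) \<and>
     (\<forall>j<q_window M. q_Wf M j \<in> carrier_mat (q_dim M) (q_emb_dim M)) \<and>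
     (\<forall>j<q_window M. q_Wu M j \<in> carrier_mat (q_dim M) (q_emb_dim M)) \<and>
     q_bf M \<in> carrier_vec (q_dim M) \<and>
     q_bu M \<in> carrier_vec (q_dim M)"

definition q_conv :: "'a qrnn \<Rightarrow> (nat \<Rightarrow> real mat) \<Rightarrow> real vec \<Rightarrow> 'a list \<Rightarrow> nat \<Rightarrow> real vec" where
  "q_conv M W b x t =
     finsum_vec TYPE(real) (q_dim M)
       (\<lambda>j. W j *\<^sub>v token_vec (q_emb M) (q_pad M) x (t - j)) {..<q_window M} + b"

definition q_forget :: "'a qrnn \<Rightarrow> 'a list \<Rightarrow> nat \<Rightarrow> real vec" where
  "q_forget M x t = map_vec sigmoid (q_conv M (q_Wf M) (q_bf M) x t)"

definition q_input :: "'a qrnn \<Rightarrow> 'a list \<Rightarrow> nat \<Rightarrow> real vec" where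
  "q_input M x t =
     component_mult (vec (q_dim M) (\<lambda>_. 1) - q_forget M x t)
       (map_vec (q_g M) (q_conv M (q_Wu M) (q_bu M) x t))"

definition qrnn_state :: "'a qrnn \<Rightarrow> 'a list \<Rightarrow> real vec" where
  "qrnn_state M x = hidden_state (q_dim M) (q_forget M x) (q_input M x) (length x)"

end

theory Submission
  imports Defs
begin

text \<open>
  Fix a coordinate and write \<open>k = K - 1\<close>. A state of the automaton is a history (the last at most
  \<open>k\<close> tokens) together with a flag. While the flag is off, letters are read with weight 1; it is
  switched on at some position \<open>s\<close> with weight \<open>u\<^sub>s\<close>, and from then on the letter at
  position \<open>t\<close> is read with weight \<open>f\<^sub>t\<close>. Summing over \<open>s\<close> gives the unrolled
  recurrence \<open>c\<^sub>n = (\<Sum>s\<le>n. u\<^sub>s * f\<^sub>s\<^sub>+\<^sub>1 * \<dots> * f\<^sub>n)\<close>.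
  There are \<open>\<Sum>i\<le>k. |\<Sigma>| ^ i\<close> histories; those shorter than \<open>k\<close> occur only near the
  start of the input, where the window meets the padding.
\<close>

section \<open>String scores of automata without \<open>\<epsilon>\<close>-transitions\<close>

definition eps_free :: "('a, 'q, 'k::zero) wfsa \<Rightarrow> bool" where
  "eps_free A \<longleftrightarrow> (\<forall>p\<in>states A. \<forall>r\<in>states A. trans A p r None = 0)"

text \<open>One transition per letter makes this set finite when there are finitely many states,
  although epsilon moves can give a string infinitely many paths.\<close>

fun letter_paths :: "('a, 'q, 'k) wfsa \<Rightarrow> 'q \<Rightarrow> 'a list \<Rightarrow> ('q \<times> 'q \<times> 'a option) list set" where
  "letter_paths A q [] = {[]}"
| "letter_paths A q (a # x) = (\<Union>r\<in>states A. Cons (q, r, Some a) ` letter_paths A r x)"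

text \<open>The backward vector of the automaton: the weight of reading the rest of the input from
  \<open>q\<close>, with the final but without the initial weight.\<close>

fun suffix_weight :: "('a, 'q, 'k::semiring_1) wfsa \<Rightarrow> 'q \<Rightarrow> 'a list \<Rightarrow> 'k" where
  "suffix_weight A q [] = final A q"
| "suffix_weight A q (a # x) = (\<Sum>r\<in>states A. trans A q r (Some a) * suffix_weight A r x)"

abbreviation trans_weight ::
  "('a, 'q, 'k::monoid_mult) wfsa \<Rightarrow> ('q \<times> 'q \<times> 'a option) list \<Rightarrow> 'k" where
  "trans_weight A ts \<equiv> prod_list (map (\<lambda>(p, r, z). trans A p r z) ts)"

lemma finite_letter_paths: "finite (states A) \<Longrightarrow> finite (letter_paths A q x)"
  by (induction x arbitrary: q) auto

lemma path_string_simps [simp]: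
  "path_string (q, []) = []"
  "path_string (q, (p, r, None) # ts) = path_string (r, ts)"
  "path_string (q, (p, r, Some a) # ts) = a # path_string (r, ts)"
  by (simp_all add: path_string_def List.map_filter_def)

lemma is_path_start: "is_path A (q, ts) \<Longrightarrow> q \<in> states A"
  by (cases ts) auto

lemma letter_paths_derive:
  assumes "q \<in> states A" "x \<in> lists (alphabet A)" "ts \<in> letter_paths A q x"
  shows "is_path A (q, ts) \<and> path_string (q, ts) = x"
  using assms
proof (induction x arbitrary: q ts)
  case (Cons a x)
  then obtain r ts' where "r \<in> states A" "ts = (q, r, Some a) # ts'" "ts' \<in> letter_paths A r x"
    by auto
  with Cons show ?case by auto
qed simp

text \<open>Such a path must take an epsilon transition between two states somewhere, and that
  factor of the product is 0.\<close>

lemma trans_weight_eps_path: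
  fixes A :: "('a, 'q, 'k::semiring_1) wfsa"
  assumes "eps_free A" "is_path A (q, ts)" "ts \<notin> letter_paths A q (path_string (q, ts))"
  shows "trans_weight A ts = 0"
  using assms(2-3)
proof (induction ts arbitrary: q)
  case (Cons t ts)
  obtain p r z where t: "t = (p, r, z)" by (cases t)
  have path: "is_path A (r, ts)" and p: "p = q" "q \<in> states A"
    using Cons.prems(1) by (auto simp: t)
  have r: "r \<in> states A" using path by (rule is_path_start)
  show ?case
  proof (cases z)
    case None
    with assms(1) p r show ?thesis by (simp add: t eps_free_def)
  next
    case (Some a)
    with Cons.prems(2) r p have "ts \<notin> letter_paths A r (path_string (r, ts))"
      by (auto simp: t)
    with Cons.IH path show ?thesis by (simp add: t)
  qed
qed simp

text \<open>Distributivity: paths are grouped by the target of their first transition, whose weight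
  is then factored out on the left.\<close>

lemma sum_letter_paths:
  fixes A :: "('a, 'q, 'k::semiring_1) wfsa"
  assumes "finite (states A)"
  shows "(\<Sum>ts\<in>letter_paths A q x. trans_weight A ts * final A (path_end (q, ts))) = suffix_weight A q x"
proof (induction x arbitrary: q)
  case (Cons a x)
  let ?w = "\<lambda>q ts. trans_weight A ts * final A (path_end (q, ts))"
  have "(\<Sum>ts\<in>letter_paths A q (a # x). ?w q ts)
      = (\<Sum>r\<in>states A. \<Sum>ts\<in>Cons (q, r, Some a) ` letter_paths A r x. ?w q ts)"
    unfolding letter_paths.simps
    by (rule sum.UNION_disjoint) (use assms finite_letter_paths[OF assms] in auto)
  also have "\<dots> = (\<Sum>r\<in>states A. \<Sum>ts\<in>letter_paths A r x. trans A q r (Some a) * ?w r ts)"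
    by (simp add: sum.reindex mult.assoc)
  also have "\<dots> = suffix_weight A q (a # x)"
    by (simp add: Cons.IH flip: sum_distrib_left)
  finally show ?case .
qed simp

text \<open>All paths outside a finite set have score 0, so the infinite sum reduces to a finite one
  and converges in any topology considered here.\<close>

lemma has_string_score_eps_free:
  fixes A :: "('a, 'q, 'k::{semiring_1, t2_space}) wfsa"
  assumes "eps_free A" "finite (states A)" "x \<in> lists (alphabet A)"
  shows "has_string_score A x (\<Sum>q\<in>states A. init A q * suffix_weight A q x)"
proof -
  let ?L = "Sigma (states A) (\<lambda>q. letter_paths A q x)"
  have "(\<Sum>\<pi>\<in>?L. path_score A \<pi>) = (\<Sum>q\<in>states A. \<Sum>ts\<in>letter_paths A q x. path_score A (q, ts))"
    using assms(2) finite_letter_paths[OF assms(2)] by (subst sum.Sigma) auto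
  also have "\<dots> = (\<Sum>q\<in>states A. init A q * suffix_weight A q x)"
    by (simp add: path_score_def mult.assoc sum_letter_paths[OF assms(2)] flip: sum_distrib_left)
  finally have "(path_score A has_sum (\<Sum>q\<in>states A. init A q * suffix_weight A q x)) ?L"
    using assms(2) finite_letter_paths[OF assms(2)] by (intro has_sum_finiteI) auto
  moreover have "path_score A \<pi> = 0" if "\<pi> \<notin> ?L" "is_path A \<pi>" "path_string \<pi> = x" for \<pi>
    using that trans_weight_eps_path[OF assms(1), of "fst \<pi>" "snd \<pi>"] is_path_start[of A "fst \<pi>" "snd \<pi>"]
    by (cases \<pi>) (auto simp: path_score_def)
  ultimately show ?thesis
    unfolding has_string_score_def using letter_paths_derive[OF _ assms(3)]
    by (subst has_sum_cong_neutral[where T = ?L and g = "path_score A"]) auto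
qed

text \<open>Bridges the gap between states built as flag-history pairs and the natural numbers
  required by \<open>recovers\<close>, by transport along a bijection.\<close>

lemma relabel_states:
  fixes A :: "('a, 'q, 'k::semiring_1) wfsa"
  assumes "finite (states A)" "eps_free A"
  obtains B :: "('a, nat, 'k) wfsa" where
    "finite (states B)" "eps_free B" "alphabet B = alphabet A" "card (states B) = card (states A)"
    "\<And>x. (\<Sum>q\<in>states B. init B q * suffix_weight B q x) = (\<Sum>q\<in>states A. init A q * suffix_weight A q x)"
proof -
  obtain g where g: "bij_betw g {..<card (states A)} (states A)"
    using ex_bij_betw_nat_finite[OF assms(1)] by (auto simp: lessThan_atLeast0)
  define B :: "('a, nat, 'k) wfsa" where
    "B = \<lparr>alphabet = alphabet A, states = {..<card (states A)},
          trans = (\<lambda>i j. trans A (g i) (g j)), init = init A \<circ> g, final = final A \<circ> g\<rparr>"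
  have sel [simp]: "alphabet B = alphabet A" "states B = {..<card (states A)}"
    "trans B i j = trans A (g i) (g j)" "init B i = init A (g i)" "final B i = final A (g i)" for i j
    by (simp_all add: B_def)
  have re: "(\<Sum>i<card (states A). h (g i)) = sum h (states A)" for h :: "'q \<Rightarrow> 'k"
    by (rule sum.reindex_bij_betw[OF g])
  have sw: "suffix_weight B i x = suffix_weight A (g i) x" for i x
    by (induction x arbitrary: i)
      (simp_all add: re[where h = "\<lambda>r. trans A (g _) r (Some _) * suffix_weight A r _"])
  have "eps_free B"
    using assms(2) bij_betwE[OF g] by (auto simp: eps_free_def)
  then show thesis
    by (intro that[of B]) (simp_all add: sw re[where h = "\<lambda>r. init A r * suffix_weight A r _"])
qed

section \<open>Gated recurrences driven by a finite history\<close>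

text \<open>The hidden value is an accumulator, so the input is consumed from the left, as in
  \<open>suffix_weight\<close>.\<close>

primrec gated_run ::
  "('h \<Rightarrow> 'a \<Rightarrow> 'h) \<Rightarrow> ('h \<Rightarrow> 'a \<Rightarrow> 'k::semiring_1) \<Rightarrow> ('h \<Rightarrow> 'a \<Rightarrow> 'k) \<Rightarrow> 'a list \<Rightarrow> 'h \<Rightarrow> 'k \<Rightarrow> 'k" where
  "gated_run \<delta> f u [] h c = c"
| "gated_run \<delta> f u (a # x) h c = gated_run \<delta> f u x (\<delta> h a) (f h a * c + u h a)"

text \<open>For a fixed history and letter, the weights between flags form a triangular matrix with
  rows \<open>f h a, 0\<close> and \<open>u h a, 1\<close> (\<open>True\<close> first). Such
  matrices compose like the affine maps sending \<open>c\<close> to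
  \<open>f h a * c + u h a\<close>.\<close>

definition gated_wfsa ::
  "'a set \<Rightarrow> 'h set \<Rightarrow> ('h \<Rightarrow> 'a \<Rightarrow> 'h) \<Rightarrow> 'h \<Rightarrow> ('h \<Rightarrow> 'a \<Rightarrow> 'k::semiring_1) \<Rightarrow> ('h \<Rightarrow> 'a \<Rightarrow> 'k) \<Rightarrow>
   ('a, bool \<times> 'h, 'k) wfsa" where
  "gated_wfsa \<Sigma> H \<delta> h0 f u =
     \<lparr>alphabet = \<Sigma>, states = UNIV \<times> H,
      trans = (\<lambda>(b, h) (b', h') z. case z of None \<Rightarrow> 0
                | Some a \<Rightarrow> if h' \<noteq> \<delta> h a then 0
                            else if b then if b' then f h a else 0
                            else if b' then u h a else 1),
      init = (\<lambda>(b, h). if \<not> b \<and> h = h0 then 1 else 0),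
      final = (\<lambda>(b, h). if b then 1 else 0)\<rparr>"

text \<open>The run is an affine function of its start value: the weight from the switched-on state
  is the slope, that from the switched-off state the constant term.\<close>

lemma suffix_weight_gated_wfsa:
  fixes f u :: "'h \<Rightarrow> 'a \<Rightarrow> 'k::comm_semiring_1"
    and h0 :: 'h
  assumes "finite H" "\<And>h a. h \<in> H \<Longrightarrow> a \<in> \<Sigma> \<Longrightarrow> \<delta> h a \<in> H" "h \<in> H" "x \<in> lists \<Sigma>"
  defines "A \<equiv> gated_wfsa \<Sigma> H \<delta> h0 f u"
  shows "gated_run \<delta> f u x h c = suffix_weight A (True, h) x * c + suffix_weight A (False, h) x"
  using assms(3,4)
proof (induction x arbitrary: h c)
  case Nil
  then show ?case by (simp add: A_def gated_wfsa_def)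
next
  case (Cons a x)
  then have in_H: "\<delta> h a \<in> H" using assms(2) by simp
  have split: "(\<Sum>r\<in>states A. g r) = (\<Sum>h\<in>H. g (True, h)) + (\<Sum>h\<in>H. g (False, h))"
    for g :: "bool \<times> 'h \<Rightarrow> 'k"
  proof -
    have "(\<Sum>r\<in>states A. g r) = (\<Sum>b\<in>UNIV. \<Sum>h\<in>H. g (b, h))"
      by (simp add: A_def gated_wfsa_def sum.cartesian_product)
    then show ?thesis by (simp add: UNIV_bool add.commute)
  qed
  \<comment> \<open>Histories evolve deterministically, so only one summand survives.\<close>
  have delta: "(\<Sum>h'\<in>H. (if h' \<noteq> \<delta> h a then 0 else w) * g h') = w * g (\<delta> h a)" for w and g :: "'h \<Rightarrow> 'k"
  proof -
    have "(\<Sum>h'\<in>H. (if h' \<noteq> \<delta> h a then 0 else w) * g h') = (\<Sum>h'\<in>H. if h' = \<delta> h a then w * g h' else 0)"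
      by (rule sum.cong) auto
    then show ?thesis using assms(1) in_H by simp
  qed
  have tr: "trans A (b, h) (b', h') (Some a) = (if h' \<noteq> \<delta> h a then 0
      else (if b then if b' then f h a else 0 else if b' then u h a else 1))" for b b' h'
    by (simp add: A_def gated_wfsa_def)
  have on: "suffix_weight A (True, h) (a # x) = f h a * suffix_weight A (True, \<delta> h a) x"
    and off: "suffix_weight A (False, h) (a # x)
        = u h a * suffix_weight A (True, \<delta> h a) x + suffix_weight A (False, \<delta> h a) x"
    unfolding suffix_weight.simps split tr
    using delta by simp_all
  \<comment> \<open>The induction hypothesis is used at the new accumulator
    \<open>f h a * c + u h a\<close>; commutativity collects the slope.\<close>
  show ?case
    unfolding on off using Cons in_H by (simp add: algebra_simps)
qed

text \<open>The initial weights select the switched-off state at \<open>h0\<close>, and the start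
  value 0 leaves only the constant term. The factor 2 counts the flags.\<close>

lemma gated_run_recognized:
  fixes f u :: "'h \<Rightarrow> 'a \<Rightarrow> 'k::{comm_semiring_1, t2_space}"
  assumes "finite \<Sigma>" "finite H" "\<And>h a. h \<in> H \<Longrightarrow> a \<in> \<Sigma> \<Longrightarrow> \<delta> h a \<in> H" "h0 \<in> H"
  obtains A :: "('a, nat, 'k) wfsa" where
    "is_wfsa A" "alphabet A = \<Sigma>" "card (states A) = 2 * card H"
    "\<And>x. x \<in> lists \<Sigma> \<Longrightarrow> has_string_score A x (gated_run \<delta> f u x h0 0)"
proof -
  let ?G = "gated_wfsa \<Sigma> H \<delta> h0 f u"
  have "finite (states ?G)" "eps_free ?G"
    using assms(2) by (auto simp: gated_wfsa_def eps_free_def)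
  then obtain A :: "('a, nat, 'k) wfsa" where A:
    "finite (states A)" "eps_free A" "alphabet A = alphabet ?G" "card (states A) = card (states ?G)"
    "\<And>x. (\<Sum>q\<in>states A. init A q * suffix_weight A q x) = (\<Sum>q\<in>states ?G. init ?G q * suffix_weight ?G q x)"
    by (rule relabel_states) blast
  have alph: "alphabet A = \<Sigma>" by (simp add: A(3) gated_wfsa_def)
  have "has_string_score A x (gated_run \<delta> f u x h0 0)" if x: "x \<in> lists \<Sigma>" for x
  proof -
    have init: "init ?G q = (if q = (False, h0) then 1 else 0)" for q
      by (cases q) (simp add: gated_wfsa_def)
    have "(\<Sum>q\<in>states ?G. init ?G q * suffix_weight ?G q x)
        = (\<Sum>q\<in>UNIV \<times> H. if q = (False, h0) then suffix_weight ?G q x else 0)"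
      by (rule sum.cong) (simp_all add: init, simp add: gated_wfsa_def)
    also have "\<dots> = suffix_weight ?G (False, h0) x"
      using assms(2,4) by (simp add: sum.delta)
    also have "\<dots> = gated_run \<delta> f u x h0 0"
      using suffix_weight_gated_wfsa[where \<delta> = \<delta> and \<Sigma> = \<Sigma> and f = f and u = u and ?h0.0 = h0 and c = 0,
          OF assms(2-4) x] by simp
    finally show ?thesis
      using has_string_score_eps_free[OF A(2,1), of x] x by (simp add: A(5) alph)
  qed
  moreover have "card (states A) = 2 * card H"
    by (simp add: A(4) gated_wfsa_def card_cartesian_product)
  ultimately show thesis
    using A(1) alph assms(1) by (intro that[of A]) (simp_all add: is_wfsa_def)
qed

section \<open>Windows\<close>

definition lastn :: "nat \<Rightarrow> 'a list \<Rightarrow> 'a list" where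
  "lastn n xs = drop (length xs - n) xs"

lemma length_lastn [simp]: "length (lastn n xs) = min n (length xs)"
  by (simp add: lastn_def)

lemma lastn_Nil [simp]: "lastn n [] = []"
  by (simp add: lastn_def)

lemma lastn_lists: "xs \<in> lists S \<Longrightarrow> lastn n xs \<in> lists S"
  by (auto simp: lastn_def dest: in_set_dropD)

lemma lastn_Suc_snoc: "lastn (Suc n) (xs @ [a]) = lastn n xs @ [a]"
  by (simp add: lastn_def)

text \<open>This makes a history usable as a state: its update needs only the old history and the
  new letter.\<close>

lemma lastn_lastn_snoc: "lastn n (lastn n xs @ [a]) = lastn n (xs @ [a])"
  by (cases "length xs \<le> n") (auto simp: lastn_def Suc_diff_le)

text \<open>A full window has length \<open>K > j\<close>, so neither index reaches the padding. A
  shorter window is the whole prefix, and both sides reach the padding together.\<close>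

lemma token_vec_lastn:
  assumes "t \<le> length x" "j < K"
  shows "token_vec v p x (t - j) = token_vec v p (lastn K (take t x)) (length (lastn K (take t x)) - j)"
  using assms by (auto simp: token_vec_def lastn_def min_def Suc_diff_Suc)

text \<open>Locality is expressed by feeding the window back to \<open>f\<close> as an input of its
  own; a window shorter than \<open>K\<close> thereby reproduces the padding.\<close>

definition windowed :: "nat \<Rightarrow> nat \<Rightarrow> 'a set \<Rightarrow> ('a list \<Rightarrow> nat \<Rightarrow> real vec) \<Rightarrow> bool" where
  "windowed d K \<Sigma> f \<longleftrightarrow> (\<forall>x\<in>lists \<Sigma>. \<forall>t. 1 \<le> t \<longrightarrow> t \<le> length x \<longrightarrow>
     f x t \<in> carrier_vec d \<and> f x t = f (lastn K (take t x)) (length (lastn K (take t x))))"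

lemma windowedI:
  assumes "\<And>x t. x \<in> lists \<Sigma> \<Longrightarrow> t \<le> length x \<Longrightarrow> f x t \<in> carrier_vec d"
    and "\<And>x t w. t \<le> length x \<Longrightarrow> w = lastn K (take t x) \<Longrightarrow> f x t = f w (length w)"
  shows "windowed d K \<Sigma> f"
  using assms unfolding windowed_def by blast

lemma windowedD:
  assumes "windowed d K \<Sigma> f" "x \<in> lists \<Sigma>" "1 \<le> t" "t \<le> length x"
  shows "f x t \<in> carrier_vec d \<and> f x t = f (lastn K (take t x)) (length (lastn K (take t x)))"
  using assms unfolding windowed_def by blast

lemma dim_hidden_state:
  assumes "\<And>s. 1 \<le> s \<Longrightarrow> s \<le> t \<Longrightarrow> u s \<in> carrier_vec d"
  shows "dim_vec (hidden_state d f u t) = d"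
  using assms by (cases t) auto

lemma hidden_state_eq_gated_run:
  assumes f: "windowed d (Suc k) \<Sigma> f" and u: "windowed d (Suc k) \<Sigma> u" and x: "x \<in> lists \<Sigma>" and i: "i < d"
  shows "hidden_state d (f x) (u x) (length x) $ i =
    gated_run (\<lambda>h a. lastn k (h @ [a]))
      (\<lambda>h a. f (h @ [a]) (length (h @ [a])) $ i) (\<lambda>h a. u (h @ [a]) (length (h @ [a])) $ i) x [] 0"
proof -
  let ?run = "gated_run (\<lambda>h a. lastn k (h @ [a]))
      (\<lambda>h a. f (h @ [a]) (length (h @ [a])) $ i) (\<lambda>h a. u (h @ [a]) (length (h @ [a])) $ i)"
  let ?c = "\<lambda>t. hidden_state d (f x) (u x) t $ i"
  \<comment> \<open>Invariant: after \<open>t\<close> tokens the history is the last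
    \<open>k\<close> of them and the accumulator is the hidden state. It is shown downwards from
    \<open>t = length x\<close>, where no input is left; \<open>t = 0\<close> is the claim.\<close>
  have "?run (drop t x) (lastn k (take t x)) (?c t) = ?c (length x)" if "t \<le> length x" for t
    using that
  proof (induction rule: inc_induct)
    case base
    show ?case by simp
  next
    case (step t)
    let ?w = "lastn k (take t x) @ [x ! t]"
    \<comment> \<open>Tokens count from 1 and list positions from 0: the window at
      \<open>Suc t\<close> is the history of \<open>k\<close> tokens followed by
      \<open>x ! t\<close>.\<close>
    have w: "lastn (Suc k) (take (Suc t) x) = ?w"
      using step.hyps by (simp add: take_Suc_conv_app_nth lastn_Suc_snoc)
    have fu: "f x (Suc t) = f ?w (length ?w)" "f x (Suc t) \<in> carrier_vec d"
      "u x (Suc t) = u ?w (length ?w)" "u x (Suc t) \<in> carrier_vec d"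
      using windowedD[OF f x, of "Suc t"] windowedD[OF u x, of "Suc t"] step.hyps
      unfolding w Suc_le_eq One_nat_def by blast+
    have "dim_vec (hidden_state d (f x) (u x) t) = d"
      using step.hyps by (intro dim_hidden_state windowedD[OF u x, THEN conjunct1]) auto
    then have c: "?c (Suc t) = f ?w (length ?w) $ i * ?c t + u ?w (length ?w) $ i"
      using i fu by (simp add: component_mult_def)
    have "drop t x = x ! t # drop (Suc t) x"
      using step.hyps by (simp add: Cons_nth_drop_Suc)
    moreover have "lastn k ?w = lastn k (take (Suc t) x)"
      using step.hyps by (simp add: lastn_lastn_snoc take_Suc_conv_app_nth)
    ultimately show ?case
      using step.IH c by simp
  qed
  from this[of 0] i show ?thesis by simp
qed

text \<open>The elementwise product keeps coordinates independent, so each gets its own automaton.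
  The sum counts the histories by length.\<close>

lemma windowed_recovered:
  assumes "finite \<Sigma>" "windowed d (Suc k) \<Sigma> f" "windowed d (Suc k) \<Sigma> u"
  obtains A where "recovers \<Sigma> d (\<lambda>x. hidden_state d (f x) (u x) (length x)) A"
    "\<And>i. i < d \<Longrightarrow> card (states (A i)) = 2 * (\<Sum>j\<le>k. card \<Sigma> ^ j)"
proof -
  let ?H = "{h. set h \<subseteq> \<Sigma> \<and> length h \<le> k}"
  have "\<exists>A :: ('a, nat, real) wfsa. is_wfsa A \<and> alphabet A = \<Sigma> \<and> card (states A) = 2 * card ?H \<and>
      (\<forall>x\<in>lists \<Sigma>. has_string_score A x (hidden_state d (f x) (u x) (length x) $ i))" if i: "i < d" for i
  proof -
    let ?\<delta> = "\<lambda>h a. lastn k (h @ [a])"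
    have closed: "?\<delta> h a \<in> ?H" if "h \<in> ?H" "a \<in> \<Sigma>" for h a
      using that lastn_lists[of "h @ [a]" \<Sigma> k] by (auto simp: lists_eq_set)
    have start: "[] \<in> ?H" by simp
    obtain A :: "('a, nat, real) wfsa" where
      "is_wfsa A" "alphabet A = \<Sigma>" "card (states A) = 2 * card ?H"
      "\<And>x. x \<in> lists \<Sigma> \<Longrightarrow> has_string_score A x (gated_run ?\<delta> (\<lambda>h a. f (h @ [a]) (length (h @ [a])) $ i)
         (\<lambda>h a. u (h @ [a]) (length (h @ [a])) $ i) x [] 0)"
      by (rule gated_run_recognized[where \<Sigma> = \<Sigma> and H = ?H and \<delta> = ?\<delta> and ?h0.0 = "[]"
          and f = "\<lambda>h a. f (h @ [a]) (length (h @ [a])) $ i"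
          and u = "\<lambda>h a. u (h @ [a]) (length (h @ [a])) $ i",
          OF assms(1) finite_lists_length_le[OF assms(1)] closed start]) (assumption | rule that)+
    then show ?thesis
      using hidden_state_eq_gated_run[OF assms(2,3) _ i] by (intro exI[of _ A]) simp
  qed
  then have "\<exists>A :: nat \<Rightarrow> ('a, nat, real) wfsa. \<forall>i<d. is_wfsa (A i) \<and> alphabet (A i) = \<Sigma> \<and>
      card (states (A i)) = 2 * card ?H \<and>
      (\<forall>x\<in>lists \<Sigma>. has_string_score (A i) x (hidden_state d (f x) (u x) (length x) $ i))"
    by (intro choice_iff'[THEN iffD1]) simp
  then obtain A :: "nat \<Rightarrow> ('a, nat, real) wfsa" where
    "\<forall>i<d. is_wfsa (A i) \<and> alphabet (A i) = \<Sigma> \<and> card (states (A i)) = 2 * card ?H \<and>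
      (\<forall>x\<in>lists \<Sigma>. has_string_score (A i) x (hidden_state d (f x) (u x) (length x) $ i))"
    by (rule exE)
  then show thesis
    by (intro that[of A]) (simp_all add: recovers_def card_lists_length_le[OF assms(1)])
qed

text \<open>For \<open>\<Sigma> = {}\<close> and \<open>K > 1\<close> the bound \<open>|\<Sigma>| ^ (K - 1)\<close> is 0 and leaves no room for a state.\<close>

lemma recovers_empty_alphabet:
  fixes c :: "'a list \<Rightarrow> 'k::{semiring_1, t2_space} vec"
  assumes "c [] = 0\<^sub>v d"
  obtains A where "recovers {} d c A" "\<And>i. states (A i) = {}"
proof -
  define A :: "('a, nat, 'k) wfsa" where
    "A = \<lparr>alphabet = {}, states = {}, trans = (\<lambda>_ _ _. 0), init = (\<lambda>_. 0), final = (\<lambda>_. 0)\<rparr>"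
  \<comment> \<open>The empty string is the only one over this alphabet, and its score is an empty
    sum.\<close>
  have "has_string_score A [] 0"
    using has_string_score_eps_free[of A "[]"] by (simp add: A_def eps_free_def)
  with assms show thesis
    by (intro that[of "\<lambda>_. A"]) (simp_all add: recovers_def is_wfsa_def A_def)
qed

section \<open>The models\<close>

text \<open>Only offsets 0 and 1 from the current token are read, hence window size 2.\<close>

lemma windowed_t_rnn:
  assumes "is_t_rnn \<Sigma> M"
  shows "windowed (t_dim M) 2 \<Sigma> (t_forget M)" "windowed (t_dim M) 2 \<Sigma> (t_input M)"
proof -
  have carrier: "token_vec (t_emb M) (t_pad M) x t \<in> carrier_vec (t_emb_dim M)"
    if "x \<in> lists \<Sigma>" "t \<le> length x" for x t
    using that assms nth_mem[of "t - 1" x]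
    by (auto simp: token_vec_def is_t_rnn_def lists_eq_set image_subset_iff subset_iff)
  have window: "token_vec v p x t = token_vec v p w (length w)"
    "token_vec v p x (t - 1) = token_vec v p w (length w - 1)"
    if "t \<le> length x" "w = lastn 2 (take t x)" for v p and x w :: "'a list" and t
    using token_vec_lastn[OF that(1), of 0 2 v p] token_vec_lastn[OF that(1), of 1 2 v p]
    unfolding that(2) by simp_all
  have dim_bf: "dim_vec (t_bf M) = t_dim M"
    and inp: "\<And>a b. a \<in> carrier_vec (t_emb_dim M) \<Longrightarrow> b \<in> carrier_vec (t_emb_dim M) \<Longrightarrow>
      t_inp M a b \<in> carrier_vec (t_dim M)"
    using assms unfolding is_t_rnn_def by (blast dest: carrier_vecD)+
  show "windowed (t_dim M) 2 \<Sigma> (t_forget M)"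
  proof (rule windowedI)
    show "t_forget M x t \<in> carrier_vec (t_dim M)" for x t
      by (rule carrier_vecI) (simp add: t_forget_def Let_def dim_bf)
    show "t_forget M x t = t_forget M w (length w)" if "t \<le> length x" "w = lastn 2 (take t x)" for x t w
      unfolding t_forget_def Let_def window[OF that] ..
  qed
  show "windowed (t_dim M) 2 \<Sigma> (t_input M)"
  proof (rule windowedI)
    show "t_input M x t \<in> carrier_vec (t_dim M)" if "x \<in> lists \<Sigma>" "t \<le> length x" for x t
      using that unfolding t_input_def Let_def by (intro inp carrier) simp_all
    show "t_input M x t = t_input M w (length w)" if "t \<le> length x" "w = lastn 2 (take t x)" for x t w
      unfolding t_input_def Let_def window[OF that] ..
  qed
qed

text \<open>\<open>finsum_vec\<close> is a \<open>finprod\<close> in a monoid with an explicit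
  carrier, so congruence asks for membership of the summands.\<close>

lemma finsum_vec_cong:
  fixes g :: "'b \<Rightarrow> 'c::comm_monoid_add vec"
  assumes "\<And>j. j \<in> S \<Longrightarrow> g j \<in> carrier_vec n" "\<And>j. j \<in> S \<Longrightarrow> f j = g j"
  shows "finsum_vec TYPE('c) n f S = finsum_vec TYPE('c) n g S"
  unfolding finsum_vec_def
  by (rule comm_monoid.finprod_cong'[OF comm_monoid_vec])
    (use assms in \<open>simp_all add: monoid_vec_simps Pi_def\<close>)

text \<open>Each summand reads one token at an offset below the window size, and the window retains
  it.\<close>

lemma windowed_q_conv:
  assumes "\<forall>j<q_window M. W j \<in> carrier_mat (q_dim M) n" "t \<le> length x"
  shows "q_conv M W b x t
    = q_conv M W b (lastn (q_window M) (take t x)) (length (lastn (q_window M) (take t x)))"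
  unfolding q_conv_def
proof (intro arg_cong2[where f = "(+)"] refl finsum_vec_cong)
  fix j assume "j \<in> {..<q_window M}"
  then have j: "j < q_window M" by simp
  show "W j *\<^sub>v v \<in> carrier_vec (q_dim M)" for v
    by (rule carrier_vecI) (use assms(1) j in auto)
  show "W j *\<^sub>v token_vec (q_emb M) (q_pad M) x (t - j)
      = W j *\<^sub>v token_vec (q_emb M) (q_pad M) (lastn (q_window M) (take t x))
          (length (lastn (q_window M) (take t x)) - j)"
    unfolding token_vec_lastn[OF assms(2) j] ..
qed

lemma windowed_qrnn:
  assumes "is_qrnn \<Sigma> M"
  shows "windowed (q_dim M) (q_window M) \<Sigma> (q_forget M)" "windowed (q_dim M) (q_window M) \<Sigma> (q_input M)"
proof -
  have Wf: "\<forall>j<q_window M. q_Wf M j \<in> carrier_mat (q_dim M) (q_emb_dim M)"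
    and Wu: "\<forall>j<q_window M. q_Wu M j \<in> carrier_mat (q_dim M) (q_emb_dim M)"
    and dims: "dim_vec (q_bf M) = q_dim M" "dim_vec (q_bu M) = q_dim M"
    using assms by (auto simp: is_qrnn_def)
  have forget: "q_forget M x t = q_forget M w (length w)"
    if "t \<le> length x" "w = lastn (q_window M) (take t x)" for x t w
    unfolding q_forget_def windowed_q_conv[OF Wf that(1)] that(2) ..
  show "windowed (q_dim M) (q_window M) \<Sigma> (q_forget M)"
  proof (rule windowedI)
    show "q_forget M x t \<in> carrier_vec (q_dim M)" for x t
      by (rule carrier_vecI) (simp add: q_forget_def q_conv_def dims)
  qed (rule forget)
  show "windowed (q_dim M) (q_window M) \<Sigma> (q_input M)"
  proof (rule windowedI)
    show "q_input M x t \<in> carrier_vec (q_dim M)" for x t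
      by (rule carrier_vecI) (simp add: q_input_def q_forget_def q_conv_def dims dim_component_mult)
    show "q_input M x t = q_input M w (length w)"
      if "t \<le> length x" "w = lastn (q_window M) (take t x)" for x t w
      unfolding q_input_def forget[OF that] windowed_q_conv[OF Wu that(1)] that(2) ..
  qed
qed

section \<open>Counting the states for QRNNs\<close>

text \<open>With at least two letters the longest histories dominate, with a factor independent of
  \<open>k\<close>.\<close>

lemma geometric_sum_le:
  fixes s :: nat
  assumes "2 \<le> s"
  shows "(\<Sum>j\<le>k. s ^ j) \<le> 2 * s ^ k"
proof (induction k)
  case (Suc k)
  have "2 * s ^ k \<le> s * s ^ k" using assms by (intro mult_right_mono) auto
  with Suc show ?case unfolding sum.atMost_Suc power_Suc by linarith
qed simp

lemma qrnn_recovered: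
  assumes "finite \<Sigma>" "is_qrnn \<Sigma> M"
  obtains A where "recovers \<Sigma> (q_dim M) (qrnn_state M) A"
    "\<And>i. i < q_dim M \<Longrightarrow> card (states (A i)) = 2 * (\<Sum>j\<le>q_window M - 1. card \<Sigma> ^ j)"
proof -
  have "Suc (q_window M - 1) = q_window M"
    using assms(2) by (simp add: is_qrnn_def)
  then show thesis
    using windowed_recovered[OF assms(1), of "q_dim M" "q_window M - 1" "q_forget M" "q_input M"]
      windowed_qrnn[OF assms(2)] that
    unfolding qrnn_state_def[abs_def] by metis
qed

text \<open>Each of the \<open>q_window M\<close> summands is at most the last. This covers
  one-letter alphabets, where the factor \<open>q_window M\<close> is attained by the sum.\<close>

lemma qrnn_state_count:
  assumes "finite \<Sigma>" "is_qrnn \<Sigma> M"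
  obtains A where "recovers \<Sigma> (q_dim M) (qrnn_state M) A"
    "\<And>i. i < q_dim M \<Longrightarrow> card (states (A i)) \<le> q_window M * (2 * card \<Sigma> ^ (q_window M - 1))"
\<comment> \<open>In the case split off, the last power is 0 and fails to dominate
  \<open>0 ^ 0 = 1\<close>.\<close>
proof (cases "\<Sigma> = {} \<and> q_window M \<noteq> 1")
  case True
  have "qrnn_state M [] = 0\<^sub>v (q_dim M)" by (simp add: qrnn_state_def)
  then show thesis
    using True that by (metis recovers_empty_alphabet card.empty zero_le)
next
  case False
  obtain A where A: "recovers \<Sigma> (q_dim M) (qrnn_state M) A"
    "\<And>i. i < q_dim M \<Longrightarrow> card (states (A i)) = 2 * (\<Sum>j\<le>q_window M - 1. card \<Sigma> ^ j)"
    using qrnn_recovered[OF assms] by blast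
  have "card \<Sigma> ^ j \<le> card \<Sigma> ^ (q_window M - 1)" if "j \<le> q_window M - 1" for j
    using False that assms by (cases "\<Sigma> = {}") (auto intro!: power_increasing simp: Suc_le_eq card_gt_0_iff)
  then have "(\<Sum>j\<le>q_window M - 1. card \<Sigma> ^ j) \<le> (\<Sum>j\<le>q_window M - 1. card \<Sigma> ^ (q_window M - 1))"
    by (intro sum_mono) simp
  also have "\<dots> = q_window M * card \<Sigma> ^ (q_window M - 1)"
    using assms(2) by (simp add: is_qrnn_def)
  finally show thesis
    using A by (intro that[of A]) auto
qed

text \<open>Over one letter there are \<open>K\<close> histories while
  \<open>card \<Sigma> ^ (K - 1)\<close> is 1. Hence the bound has two forms: a constant uniform in
  \<open>K\<close> for at least two letters, and one depending on \<open>K\<close> for every finite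
  alphabet.\<close>

theorem proposition11:
  shows
    "(\<forall>(\<Sigma> :: 'a set) (M :: 'a t_rnn). finite \<Sigma> \<and> is_t_rnn \<Sigma> M \<longrightarrow>
        rational_recurrence \<Sigma> (t_dim M) (t_rnn_state M)) \<and>
     (\<forall>(\<Sigma> :: 'a set) (M :: 'a qrnn). finite \<Sigma> \<and> is_qrnn \<Sigma> M \<longrightarrow>
        rational_recurrence \<Sigma> (q_dim M) (qrnn_state M)) \<and>
     (\<exists>C :: nat. \<forall>(\<Sigma> :: 'a set) (M :: 'a qrnn).
        finite \<Sigma> \<and> 2 \<le> card \<Sigma> \<and> is_qrnn \<Sigma> M \<longrightarrow>
        (\<exists>A. recovers \<Sigma> (q_dim M) (qrnn_state M) A \<and>
             (\<forall>i<q_dim M. card (states (A i)) \<le> C * (2 * card \<Sigma> ^ (q_window M - 1))))) \<and>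
     (\<forall>K :: nat. \<exists>C :: nat. \<forall>(\<Sigma> :: 'a set) (M :: 'a qrnn).
        finite \<Sigma> \<and> is_qrnn \<Sigma> M \<and> q_window M = K \<longrightarrow>
        (\<exists>A. recovers \<Sigma> (q_dim M) (qrnn_state M) A \<and>
             (\<forall>i<q_dim M. card (states (A i)) \<le> C * (2 * card \<Sigma> ^ (K - 1)))))"
proof (intro conjI allI impI; (elim conjE)?)
  fix \<Sigma> :: "'a set" and M :: "'a t_rnn"
  assume "finite \<Sigma>" "is_t_rnn \<Sigma> M"
  then show "rational_recurrence \<Sigma> (t_dim M) (t_rnn_state M)"
    using windowed_recovered[of \<Sigma> "t_dim M" 1 "t_forget M" "t_input M"] windowed_t_rnn[of \<Sigma> M]
    unfolding rational_recurrence_def t_rnn_state_def[abs_def] by (metis Suc_1)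
next
  fix \<Sigma> :: "'a set" and M :: "'a qrnn"
  assume "finite \<Sigma>" "is_qrnn \<Sigma> M"
  then show "rational_recurrence \<Sigma> (q_dim M) (qrnn_state M)"
    unfolding rational_recurrence_def by (metis qrnn_recovered)
next
  show "\<exists>C :: nat. \<forall>(\<Sigma> :: 'a set) (M :: 'a qrnn).
        finite \<Sigma> \<and> 2 \<le> card \<Sigma> \<and> is_qrnn \<Sigma> M \<longrightarrow>
        (\<exists>A. recovers \<Sigma> (q_dim M) (qrnn_state M) A \<and>
             (\<forall>i<q_dim M. card (states (A i)) \<le> C * (2 * card \<Sigma> ^ (q_window M - 1))))"
  \<comment> \<open>The witness 2 is the factor in \<open>geometric_sum_le\<close>.\<close>
  proof (intro exI[of _ 2] allI impI; elim conjE)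
    fix \<Sigma> :: "'a set" and M :: "'a qrnn"
    assume \<Sigma>: "finite \<Sigma>" "2 \<le> card \<Sigma>" and M: "is_qrnn \<Sigma> M"
    obtain A where "recovers \<Sigma> (q_dim M) (qrnn_state M) A"
      "\<And>i. i < q_dim M \<Longrightarrow> card (states (A i)) = 2 * (\<Sum>j\<le>q_window M - 1. card \<Sigma> ^ j)"
      using qrnn_recovered[OF \<Sigma>(1) M] by blast
    then show "\<exists>A. recovers \<Sigma> (q_dim M) (qrnn_state M) A \<and>
             (\<forall>i<q_dim M. card (states (A i)) \<le> 2 * (2 * card \<Sigma> ^ (q_window M - 1)))"
      using geometric_sum_le[OF \<Sigma>(2)] by (metis mult_le_mono2)
  qed
next
  fix K :: nat
  show "\<exists>C :: nat. \<forall>(\<Sigma> :: 'a set) (M :: 'a qrnn).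
        finite \<Sigma> \<and> is_qrnn \<Sigma> M \<and> q_window M = K \<longrightarrow>
        (\<exists>A. recovers \<Sigma> (q_dim M) (qrnn_state M) A \<and>
             (\<forall>i<q_dim M. card (states (A i)) \<le> C * (2 * card \<Sigma> ^ (K - 1))))"
    by (intro exI[of _ K] allI impI; elim conjE) (metis qrnn_state_count)
qed

end
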